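(* Let $a<b$ be real numbers and let $f:[a,b]\to\mathbb{R}$ be Riemann-integrable. Then there exist points $c_1,c_2\in(a,b)$ such that $f$ is continuous at $c_1$ and at $c_2$, and $$f(c_1)(b-a)\le\int_a^b f(x)\,dx\le f(c_2)(b-a).$$
   Context: The integral is the (proper) Riemann integral. *)

theory Defs
  imports "HOL-Analysis.Analysis"
begin

text \<open>
  The library integral \<^const>\<open>has_integral\<close> is the gauge (Henstock--Kurzweil) integral, which
  accepts more functions (for example the indicator function of the rationals). The Riemann integral
  demands a uniform mesh bound instead of a gauge: all tagged partitions whose intervals are
  shorter than \<open>\<delta>\<close> must have Riemann sums within \<open>\<epsilon>\<close> of the integral. The length of an interval \<open>K\<close> is
  \<open>measure lborel K\<close>. Only the values of \<open>f\<close> on \<open>{a..b}\<close> matter, as the tags lie there.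
\<close>

definition has_riemann_integral :: "(real \<Rightarrow> real) \<Rightarrow> real \<Rightarrow> real \<Rightarrow> real \<Rightarrow> bool" where
  "has_riemann_integral f a b I \<longleftrightarrow>
     (\<forall>\<epsilon>>0. \<exists>\<delta>>0. \<forall>p. p tagged_division_of {a..b} \<and> (\<forall>(x, K)\<in>p. measure lborel K < \<delta>) \<longrightarrow>
        \<bar>(\<Sum>(x, K)\<in>p. f x * measure lborel K) - I\<bar> < \<epsilon>)"

definition riemann_integrable :: "(real \<Rightarrow> real) \<Rightarrow> real \<Rightarrow> real \<Rightarrow> bool" where
  "riemann_integrable f a b \<longleftrightarrow> (\<exists>I. has_riemann_integral f a b I)"

definition riemann_integral :: "(real \<Rightarrow> real) \<Rightarrow> real \<Rightarrow> real \<Rightarrow> real" where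
  "riemann_integral f a b = (THE I. has_riemann_integral f a b I)"

lemma has_riemann_integral_imp_has_integral:
  assumes "has_riemann_integral f a b I"
  shows "(f has_integral I) {a..b}"
  unfolding has_integral_real
proof (intro allI impI)
  fix e :: real assume "e > 0"
  then obtain d where d: "d > 0" and
    D: "\<And>p. p tagged_division_of {a..b} \<Longrightarrow> (\<forall>(x, K)\<in>p. measure lborel K < d) \<Longrightarrow>
         \<bar>(\<Sum>(x, K)\<in>p. f x * measure lborel K) - I\<bar> < e"
    using assms unfolding has_riemann_integral_def by meson
  show "\<exists>g. gauge g \<and> (\<forall>p. p tagged_division_of {a..b} \<and> g fine p \<longrightarrow>
           norm ((\<Sum>(x, K)\<in>p. measure lborel K *\<^sub>R f x) - I) < e)"
  proof (intro exI[of _ "\<lambda>x. ball x (d / 2)"] conjI allI impI)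
    show "gauge (\<lambda>x::real. ball x (d / 2))" using d by (simp add: gauge_def)
  next
    fix p assume p: "p tagged_division_of {a..b} \<and> (\<lambda>x. ball x (d / 2)) fine p"
    have "measure lborel K < d" if "(x, K) \<in> p" for x K
    proof -
      from p that have sub: "K \<subseteq> ball x (d / 2)" and x: "x \<in> K"
        by (auto simp: fine_def)
      from p that obtain u v where K: "K = {u..v}"
        by (metis tagged_division_ofD(4) box_real(2))
      with x have "u \<in> K" "v \<in> K" by auto
      with sub have "dist x u < d / 2" "dist x v < d / 2" by auto
      then show ?thesis using K d x by (auto simp: dist_real_def)
    qed
    with p have "\<bar>(\<Sum>(x, K)\<in>p. f x * measure lborel K) - I\<bar> < e" by (intro D) auto
    then show "norm ((\<Sum>(x, K)\<in>p. measure lborel K *\<^sub>R f x) - I) < e" by (simp add: mult.commute)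
  qed
qed

lemma riemann_integral_unique:
  assumes "has_riemann_integral f a b I"
  shows "riemann_integral f a b = I"
  unfolding riemann_integral_def
  using assms by (blast intro: has_integral_unique has_riemann_integral_imp_has_integral)

end

theory Submission
  imports Defs
begin

text \<open>
  A Riemann integrable function is continuous almost everywhere: on a fine division, changing only
  the tags of the intervals on which the oscillation exceeds \<open>\<eta>\<close> changes the Riemann sum by at least
  \<open>\<eta>\<close> times their total length, so that length is small. If \<open>f\<close> exceeded its mean value \<open>m\<close> at every
  point of continuity, \<open>f - m\<close> would be positive almost everywhere and have integral zero, which
  is impossible. The other inequality follows by passing to \<open>-f\<close>.
\<close>

text \<open>Lets the tags vary while the intervals stay fixed. As the tag is a function of the
  interval, distinct pairs have distinct intervals, so disjointness of interiors is inherited from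
  \<open>D\<close>.\<close>

lemma tagged_division_of_choice:
  assumes D: "D division_of S" and t: "\<And>K. K \<in> D \<Longrightarrow> t K \<in> K"
  shows "(\<lambda>K. (t K, K)) ` D tagged_division_of S"
proof (rule tagged_division_ofI)
  show "\<Union>{K. \<exists>x. (x, K) \<in> (\<lambda>K. (t K, K)) ` D} = S"
    using division_ofD(6)[OF D] by auto
  fix x1 K1 x2 K2
  assume "(x1, K1) \<in> (\<lambda>K. (t K, K)) ` D" "(x2, K2) \<in> (\<lambda>K. (t K, K)) ` D" "(x1, K1) \<noteq> (x2, K2)"
  then have "K1 \<in> D" "K2 \<in> D" "K1 \<noteq> K2" by auto
  then show "interior K1 \<inter> interior K2 = {}" by (rule division_ofD(5)[OF D])
qed (use t division_ofD(2,4)[OF D] division_of_finite[OF D] in auto)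

text \<open>Two sums over the same fine division lie within \<open>e / 2\<close> of
  \<open>I\<close>, whatever their tags. The division is fixed before \<open>u\<close> and
  \<open>v\<close>, so the tags may be chosen to fit it.\<close>

lemma has_riemann_integral_division:
  assumes "has_riemann_integral f a b I" and "e > 0"
  obtains D where "D division_of {a..b}"
    and "\<And>u v. (\<And>K. K \<in> D \<Longrightarrow> u K \<in> K) \<Longrightarrow> (\<And>K. K \<in> D \<Longrightarrow> v K \<in> K) \<Longrightarrow>
           (\<Sum>K\<in>D. (f (u K) - f (v K)) * measure lborel K) < e"
proof -
  obtain d where d: "d > 0" and
    R: "\<And>p. p tagged_division_of {a..b} \<Longrightarrow> (\<forall>(x, K)\<in>p. measure lborel K < d) \<Longrightarrow>
         \<bar>(\<Sum>(x, K)\<in>p. f x * measure lborel K) - I\<bar> < e / 2"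
    using assms(1) \<open>e > 0\<close> unfolding has_riemann_integral_def by (meson half_gt_zero)
  \<comment> \<open>The existence of a division with small mesh comes from Cousin's lemma for a
    constant gauge: an interval inside a ball of radius \<open>d / 2\<close> about its tag is
    shorter than \<open>d\<close>.\<close>
  have "gauge (\<lambda>x::real. ball x (d / 2))" using d by (simp add: gauge_def)
  then obtain p where p: "p tagged_division_of {a..b}" and fine: "(\<lambda>x. ball x (d / 2)) fine p"
    by (rule fine_division_exists_real)
  define D where "D = snd ` p"
  have D: "D division_of {a..b}"
    unfolding D_def using p by (rule division_of_tagged_division)
  have small: "measure lborel K < d" if KD: "K \<in> D" for K
  proof -
    obtain x where x: "(x, K) \<in> p" using KD by (force simp: D_def)
    then have sub: "K \<subseteq> ball x (d / 2)" and xK: "x \<in> K"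
      using p fine by (auto simp: fine_def)
    obtain l r where K: "K = {l..r}"
      using p x by (metis tagged_division_ofD(4) box_real(2))
    with xK have "l \<in> K" "r \<in> K" by auto
    with sub have "dist x l < d / 2" "dist x r < d / 2" by auto
    then show ?thesis using K d xK by (auto simp: dist_real_def)
  qed
  have near: "\<bar>(\<Sum>K\<in>D. f (t K) * measure lborel K) - I\<bar> < e / 2"
    if "\<And>K. K \<in> D \<Longrightarrow> t K \<in> K" for t
  proof -
    have "(\<Sum>(x, K)\<in>(\<lambda>K. (t K, K)) ` D. f x * measure lborel K)
        = (\<Sum>K\<in>D. f (t K) * measure lborel K)"
      by (subst sum.reindex) (auto simp: inj_on_def)
    moreover have "\<forall>(x, K)\<in>(\<lambda>K. (t K, K)) ` D. measure lborel K < d"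
      using small by auto
    ultimately show ?thesis
      using R[OF tagged_division_of_choice[OF D that]] by simp
  qed
  show thesis
  proof (rule that[OF D])
    fix u v assume "\<And>K. K \<in> D \<Longrightarrow> u K \<in> K" "\<And>K. K \<in> D \<Longrightarrow> v K \<in> K"
    then show "(\<Sum>K\<in>D. (f (u K) - f (v K)) * measure lborel K) < e"
      using near[of u] near[of v] unfolding left_diff_distrib sum_subtractf abs_less_iff
      by fastforce
  qed
qed

text \<open>The tag change bounds the total length of the intervals in \<open>B\<close>. A point of
  the set outside these can only be an end point of a division interval, and there are finitely many
  of those.\<close>

lemma negligible_oscillation:
  assumes "has_riemann_integral f a b I" and "\<eta> > 0"
  shows "negligible {x\<in>{a..b}. \<forall>r>0. \<exists>y\<in>{a..b}. \<bar>y - x\<bar> < r \<and> \<bar>f y - f x\<bar> > \<eta>}"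
    (is "negligible ?S")
  unfolding negligible_outer_le
proof (intro allI impI)
  fix e :: real assume "e > 0"
  \<comment> \<open>The tolerance \<open>\<eta> * e\<close> leaves \<open>e\<close> once the factor
    \<open>\<eta>\<close> is cancelled.\<close>
  obtain D where D: "D division_of {a..b}"
    and osc: "\<And>u v. (\<And>K. K \<in> D \<Longrightarrow> u K \<in> K) \<Longrightarrow> (\<And>K. K \<in> D \<Longrightarrow> v K \<in> K) \<Longrightarrow>
           (\<Sum>K\<in>D. (f (u K) - f (v K)) * measure lborel K) < \<eta> * e"
    using has_riemann_integral_division[OF assms(1), of "\<eta> * e"] \<open>\<eta> > 0\<close> \<open>e > 0\<close> by auto
  note finD = division_of_finite[OF D]
  define B where "B = {K\<in>D. \<exists>y\<in>K. \<exists>z\<in>K. f y - f z > \<eta>}"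
  \<comment> \<open>Equal tags outside \<open>B\<close> make those terms vanish, so the sum over
    \<open>D\<close> reduces to one over \<open>B\<close>, where each difference exceeds
    \<open>\<eta>\<close>.\<close>
  have "\<forall>K\<in>D. \<exists>y z. y \<in> K \<and> z \<in> K \<and> (if K \<in> B then f y - f z > \<eta> else y = z)"
  proof
    fix K assume "K \<in> D"
    then obtain x where "x \<in> K" using division_ofD(3)[OF D] by blast
    then show "\<exists>y z. y \<in> K \<and> z \<in> K \<and> (if K \<in> B then f y - f z > \<eta> else y = z)"
      by (cases "K \<in> B") (auto simp: B_def)
  qed
  then obtain u v where uv: "\<And>K. K \<in> D \<Longrightarrow> u K \<in> K" "\<And>K. K \<in> D \<Longrightarrow> v K \<in> K"
    and B: "\<And>K. K \<in> B \<Longrightarrow> f (u K) - f (v K) > \<eta>"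
    and G: "\<And>K. K \<in> D \<Longrightarrow> K \<notin> B \<Longrightarrow> u K = v K"
    unfolding bchoice_iff by (metis (no_types, lifting) B_def mem_Collect_eq)
  have BD: "B \<subseteq> D" by (auto simp: B_def)
  have lm: "K \<in> lmeasurable" and ml: "measure lborel K = measure lebesgue K" if "K \<in> D" for K
    using division_ofD(4)[OF D that] by (auto simp: measure_completion)
  have "\<eta> * (\<Sum>K\<in>B. measure lebesgue K) \<le> (\<Sum>K\<in>B. (f (u K) - f (v K)) * measure lebesgue K)"
    unfolding sum_distrib_left using B by (intro sum_mono mult_right_mono) (auto simp: less_imp_le)
  also have "\<dots> = (\<Sum>K\<in>D. (f (u K) - f (v K)) * measure lborel K)"
    using BD finD G ml by (intro sum.mono_neutral_cong_left) auto
  also have "\<dots> < \<eta> * e"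
    using uv by (rule osc)
  finally have small: "(\<Sum>K\<in>B. measure lebesgue K) < e"
    using \<open>\<eta> > 0\<close> by simp
  define F where "F = (\<Union>K\<in>D. frontier K)"
  have F: "negligible F"
    unfolding F_def using finD division_ofD(4)[OF D]
    by (intro negligible_Union) (auto intro!: negligible_convex_frontier)
  have UB: "\<Union>B \<in> lmeasurable"
    using BD finD lm by (intro fmeasurable.finite_Union) (auto intro: finite_subset)
  show "\<exists>T. ?S \<subseteq> T \<and> T \<in> lmeasurable \<and> measure lebesgue T \<le> e"
  proof (intro exI conjI)
    show "?S \<subseteq> \<Union>B \<union> F"
    proof
      fix x assume x: "x \<in> ?S"
      then obtain K where K: "K \<in> D" "x \<in> K" using division_ofD(6)[OF D] by blast
      show "x \<in> \<Union>B \<union> F"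
      \<comment> \<open>In the interior, a ball about \<open>x\<close> lies in \<open>K\<close>, so
        \<open>K\<close> contains a point \<open>y\<close> with \<open>f y\<close> far from
        \<open>f x\<close>. The sign of \<open>f y - f x\<close> decides in which order the two
        points witness \<open>K \<in> B\<close>.\<close>
      proof (cases "x \<in> interior K")
        case True
        then obtain r where "r > 0" and r: "ball x r \<subseteq> K" by (auto simp: mem_interior)
        with x obtain y where "\<bar>y - x\<bar> < r" and y: "\<bar>f y - f x\<bar> > \<eta>" by blast
        then have "y \<in> K" using r by (auto simp: dist_real_def)
        then have "K \<in> B" using y K unfolding B_def by (auto simp: abs_real_def split: if_splits)
        then show ?thesis using K by blast
      next
        case False
        then show ?thesis using K closure_subset by (auto simp: F_def frontier_def)
      qed
    qed
    show "\<Union>B \<union> F \<in> lmeasurable"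
      using UB F by (simp add: fmeasurable.Un negligible_imp_measurable)
    have "measure lebesgue (\<Union>B \<union> F) \<le> measure lebesgue (\<Union>B) + measure lebesgue F"
      using UB F by (intro measure_Un_le) (auto simp: negligible_imp_sets)
    also have "\<dots> = measure lebesgue (\<Union>B)"
      by (simp add: negligible_imp_measure0[OF F])
    also have "\<dots> \<le> (\<Sum>K\<in>B. measure lebesgue K)"
      using measure_UNION_le[of B "\<lambda>K. K" lebesgue] finite_subset[OF BD finD] BD lm by auto
    finally show "measure lebesgue (\<Union>B \<union> F) \<le> e" using small by simp
  qed
qed

text \<open>A discontinuity violates the epsilon-delta condition for some \<open>e\<close>. Any
  \<open>n\<close> with \<open>inverse (real (Suc n)) < e\<close> then places it in
  \<open>?S n\<close>, one of countably many negligible sets.\<close>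

lemma has_riemann_integral_negligible_discontinuities:
  assumes "has_riemann_integral f a b I"
  shows "negligible {x\<in>{a..b}. \<not> continuous (at x within {a..b}) f}"
proof (rule negligible_subset)
  let ?S = "\<lambda>n. {x\<in>{a..b}. \<forall>r>0. \<exists>y\<in>{a..b}. \<bar>y - x\<bar> < r \<and> \<bar>f y - f x\<bar> > inverse (real (Suc n))}"
  show "negligible (\<Union>n. ?S n)"
    using negligible_oscillation[OF assms] by (intro negligible_countable_Union) auto
  show "{x\<in>{a..b}. \<not> continuous (at x within {a..b}) f} \<subseteq> (\<Union>n. ?S n)"
  proof clarify
    fix x assume x: "x \<in> {a..b}" and "\<not> continuous (at x within {a..b}) f"
    then obtain e where "e > 0"
      and e: "\<And>r. r > 0 \<Longrightarrow> \<exists>y\<in>{a..b}. \<bar>y - x\<bar> < r \<and> \<bar>f y - f x\<bar> \<ge> e"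
      unfolding continuous_within_eps_delta dist_real_def by (meson not_le)
    obtain n where "inverse (real (Suc n)) < e" using reals_Archimedean[OF \<open>e > 0\<close>] by blast
    then have "\<exists>y\<in>{a..b}. \<bar>y - x\<bar> < r \<and> \<bar>f y - f x\<bar> > inverse (real (Suc n))" if "r > 0" for r
      using e[OF that] by (meson order.strict_trans2)
    then have "x \<in> ?S n" using x by blast
    then show "x \<in> (\<Union>n. ?S n)" by blast
  qed
qed

text \<open>If the integral were zero, the nonnegative modification \<open>h\<close> would vanish
  almost everywhere; being positive off \<open>N\<close>, it would force \<open>{a..b}\<close> to be
  negligible.\<close>

lemma has_integral_pos_AE:
  fixes g :: "real \<Rightarrow> real"
  assumes "a < b" and g: "(g has_integral J) {a..b}" and N: "negligible N"
    and pos: "\<And>x. x \<in> {a..b} - N \<Longrightarrow> g x > 0"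
  shows "J > 0"
proof -
  \<comment> \<open>The sign of \<open>g\<close> on \<open>N\<close> is unknown; the value 0 there
    makes \<open>h\<close> nonnegative on all of \<open>{a..b}\<close> without changing the
    integral.\<close>
  define h where "h x = (if x \<in> N then 0 else g x)" for x
  have h: "(h has_integral J) {a..b}"
    by (rule has_integral_spike[OF N _ g]) (simp add: h_def)
  have nonneg: "h x \<ge> 0" if "x \<in> {a..b}" for x
    using pos that by (force simp: h_def)
  have J: "J \<ge> 0" using h nonneg by (rule has_integral_nonneg)
  have "J \<noteq> 0"
  proof
    assume "J = 0"
    \<comment> \<open>Nonnegativity turns gauge integrability into Lebesgue integrability, which
      gives access to the almost-everywhere criterion for a zero integral.\<close>
    have ai: "h absolutely_integrable_on {a..b}"
      using h nonneg by (intro nonnegative_absolutely_integrable_1) auto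
    then have "(LINT x|lebesgue. indicat_real {a..b} x *\<^sub>R h x) = 0"
      using set_lebesgue_integral_eq_integral(2)[OF ai] h \<open>J = 0\<close>
      by (simp add: set_lebesgue_integral_def integral_unique)
    moreover have "AE x in lebesgue. 0 \<le> indicat_real {a..b} x *\<^sub>R h x"
      using nonneg by (auto simp: indicator_def)
    ultimately have "AE x in lebesgue. indicat_real {a..b} x *\<^sub>R h x = 0"
      using ai integral_nonneg_eq_0_iff_AE unfolding set_integrable_def by blast
    then obtain M where "negligible M" and M: "{x. indicat_real {a..b} x *\<^sub>R h x \<noteq> 0} \<subseteq> M"
      unfolding eventually_ae_filter_negligible by auto
    have "{a..b} \<subseteq> M \<union> N"
    proof
      fix x assume x: "x \<in> {a..b}"
      show "x \<in> M \<union> N"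
      proof (cases "x \<in> N")
        case False
        then have "h x > 0" using pos x by (simp add: h_def)
        then show ?thesis using M x by auto
      qed simp
    qed
    then have "negligible {a..b}"
      using \<open>negligible M\<close> N by (meson negligible_Un negligible_subset)
    then show False using \<open>a < b\<close> negligible_interval(1)[of a b] by (simp add: box_eq_empty)
  qed
  with J show ?thesis by simp
qed

lemma has_riemann_integral_minus:
  assumes "has_riemann_integral f a b I"
  shows "has_riemann_integral (\<lambda>x. - f x) a b (- I)"
proof -
  have "\<bar>(\<Sum>(x, K)\<in>p. - f x * measure lborel K) - - I\<bar> = \<bar>(\<Sum>(x, K)\<in>p. f x * measure lborel K) - I\<bar>"
    for p :: "(real \<times> real set) set"
    by (simp add: case_prod_unfold sum_negf)
  then show ?thesis using assms unfolding has_riemann_integral_def by simp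
qed

lemma continuity_point_le_mean:
  assumes "a < b" and I: "has_riemann_integral f a b I"
  shows "\<exists>c\<in>{a<..<b}. continuous (at c within {a..b}) f \<and> f c * (b - a) \<le> I"
proof (rule ccontr)
  assume "\<not> ?thesis"
  then have gt: "f c * (b - a) > I"
    if "c \<in> {a<..<b}" "continuous (at c within {a..b}) f" for c
    using that by (meson not_le)
  \<comment> \<open>The end points join the exceptional set because \<open>gt\<close> speaks only of
    the open interval.\<close>
  let ?N = "{x\<in>{a..b}. \<not> continuous (at x within {a..b}) f} \<union> {a, b}"
  have "(f has_integral I) {a..b}" using I by (rule has_riemann_integral_imp_has_integral)
  moreover have "((\<lambda>x. I / (b - a)) has_integral I) {a..b}"
    using has_integral_const_real[of "I / (b - a)" a b] \<open>a < b\<close> by simp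
  ultimately have "((\<lambda>x. f x - I / (b - a)) has_integral I - I) {a..b}"
    by (rule has_integral_diff)
  moreover have "negligible ?N"
    using has_riemann_integral_negligible_discontinuities[OF I] by (simp add: negligible_Un)
  moreover have "f x - I / (b - a) > 0" if "x \<in> {a..b} - ?N" for x
    using gt[of x] that pos_divide_less_eq[of "b - a" I "f x"] \<open>a < b\<close>
    by (auto simp: order.strict_iff_order)
  ultimately have "I - I > 0" by (rule has_integral_pos_AE[OF \<open>a < b\<close>])
  then show False by simp
qed

theorem theorem4p1:
  fixes f :: "real \<Rightarrow> real" and a b :: real
  assumes "a < b"
    and "riemann_integrable f a b"
  shows "\<exists>c\<^sub>1\<in>{a<..<b}. \<exists>c\<^sub>2\<in>{a<..<b}.
           continuous (at c\<^sub>1 within {a..b}) f \<and> continuous (at c\<^sub>2 within {a..b}) f \<and>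
           f c\<^sub>1 * (b - a) \<le> riemann_integral f a b \<and>
           riemann_integral f a b \<le> f c\<^sub>2 * (b - a)"
proof -
  obtain I where I: "has_riemann_integral f a b I"
    using assms(2) by (auto simp: riemann_integrable_def)
  obtain c1 where c1: "c1 \<in> {a<..<b}" "continuous (at c1 within {a..b}) f" "f c1 * (b - a) \<le> I"
    using continuity_point_le_mean[OF assms(1) I] by blast
  \<comment> \<open>A point where \<open>- f\<close> is at most its mean is one where
    \<open>f\<close> is at least its mean.\<close>
  obtain c2 where c2: "c2 \<in> {a<..<b}" "continuous (at c2 within {a..b}) (\<lambda>x. - f x)"
    "- f c2 * (b - a) \<le> - I"
    using continuity_point_le_mean[OF assms(1) has_riemann_integral_minus[OF I]] by blast
  have "continuous (at c2 within {a..b}) f"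
    using continuous_minus[OF c2(2)] by simp
  with c1 c2 show ?thesis
    unfolding riemann_integral_unique[OF I] by fastforce
qed

end
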